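(* Fix $f\in\mathbb{R}^m$ and let $p(\cdot|f)$ be the posterior density on $\mathbb{R}^n$ given by $p(u|f)\propto\exp(-E(u;K,f)-\alpha R(u))$. Let $\hat u_{\mathrm{CM}}=\int_{\mathbb{R}^n}u\,p(u|f)\,\mathrm{d}u$ be the conditional mean estimate and let $\hat u_{\mathrm{MAP}}\in\arg\max_{u\in\mathbb{R}^n}p(u|f)$ be a maximum a posteriori estimate. Then $$\mathbb{E}\left[D_R(u,\hat u_{\mathrm{CM}})\right]\le\mathbb{E}\left[D_R(u,\hat u_{\mathrm{MAP}})\right],$$ where $\mathbb{E}[g(u)]=\int_{\mathbb{R}^n}g(u)\,p(u|f)\,\mathrm{d}u$ denotes expectation with respect to the posterior.
   Context: Setting: $K\in\mathbb{R}^{m\times n}$ is a linear forward operator, $f\in\mathbb{R}^m$ is the data, $\alpha>0$. The data fidelity $u\mapsto E(u;K,f)$ and the functional $R:\mathbb{R}^n\to\mathbb{R}$ are nonnegative, convex and Lipschitz-continuous on $\mathbb{R}^n$, and $\int_{\mathbb{R}^n}\exp(-E(u;K,f)-\alpha R(u))\,\mathrm{d}u<\infty$. The symbol $\propto$ means equality up to a positive factor independent of $u$; $p(\cdot|f)$ is normalized to be a probability density. The Bregman distance of $R$ is $D_R(u,\hat u)=D_R^{\hat p}(u,\hat u)=R(u)-R(\hat u)-\langle\hat p,u-\hat u\rangle$, where $\hat p\in\partial R(\hat u)$ is a subgradient at $\hat u$ (any chosen subgradient at $\hat u=\hat u_{\mathrm{CM}}$, respectively $\hat u=\hat u_{\mathrm{MAP}}$,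 not depending on $u$), suppressed in the notation. *)

theory Defs
  imports "HOL-Analysis.Analysis"
begin

definition subdifferential :: "('a::real_inner \<Rightarrow> real) \<Rightarrow> 'a \<Rightarrow> 'a set" where
  "subdifferential R v = {q. \<forall>u. R v + q \<bullet> (u - v) \<le> R u}"

definition bregman_distance :: "('a::real_inner \<Rightarrow> real) \<Rightarrow> 'a \<Rightarrow> 'a \<Rightarrow> 'a \<Rightarrow> real" where
  "bregman_distance R q u v = R u - R v - q \<bullet> (u - v)"

text \<open>A probability density \<open>p\<close> is \<open>normalized_density g p\<close> if \<open>p \<propto> g\<close>, i.e. \<open>p\<close> and \<open>g\<close>
  agree up to a positive factor that does not depend on the point. (Nonnegativity of \<open>p\<close> is
  inherited from \<open>g\<close>.)\<close>

definition normalized_density :: "('a::euclidean_space \<Rightarrow> real) \<Rightarrow> ('a \<Rightarrow> real) \<Rightarrow> bool" where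
  "normalized_density g p \<longleftrightarrow>
     (\<exists>c>0. \<forall>u. p u = c * g u) \<and> has_bochner_integral lborel p 1"

text \<open>The Bochner integral is \<open>0\<close> for non-integrable functions. For densities
  proportional to \<open>exp (- J)\<close> with \<open>J\<close> convex, integrability of the density forces \<open>J\<close> to grow
  at least linearly, so every integrand of at most linear growth is integrable.\<close>

definition expectation :: "('a::euclidean_space \<Rightarrow> real) \<Rightarrow> ('a \<Rightarrow> 'b) \<Rightarrow> 'b::{banach, second_countable_topology}" where
  "expectation p g = (\<integral>u. p u *\<^sub>R g u \<partial>lborel)"

end

theory Submission
  imports Defs
begin

text \<open>By linearity of the expectation \<open>\<E>[D\<^sub>R(u, v)] = \<E>[R] - (R v + \<langle>q, u\<^sub>C\<^sub>M - v\<rangle>)\<close> for every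
  \<open>v\<close> with subgradient \<open>q\<close>. The subtracted term is the value at \<open>u\<^sub>C\<^sub>M\<close> of an affine minorant of \<open>R\<close>,
  hence at most \<open>R u\<^sub>C\<^sub>M\<close>, which is what it equals for \<open>v = u\<^sub>C\<^sub>M\<close>.

  The analytic content is the existence of the first moment of the density. A convex \<open>J\<close> with \<open>exp (- J)\<close>
  integrable has bounded sublevel sets, as an unbounded one would contain arbitrarily many disjoint
  balls of a fixed radius; by convexity \<open>J\<close> then grows at least linearly.\<close>

section \<open>Dilations of Lebesgue measure\<close>

lemma integrable_lborel_scaleR:
  fixes f :: "'a::euclidean_space \<Rightarrow> 'b::{banach, second_countable_topology}"
  assumes f: "integrable lborel f" and "c \<noteq> 0"
  shows "integrable lborel (\<lambda>x. f (c *\<^sub>R x))"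
proof -
  have [measurable]: "f \<in> borel_measurable borel"
    using borel_measurable_integrable[OF f] by simp
  \<comment> \<open>Lebesgue measure is its image under the dilation by \<open>c\<close>, weighted
    with the constant Jacobian; that constant is divided out at the end.\<close>
  have "integrable (density (distr lborel borel (\<lambda>x. 0 + c *\<^sub>R x)) (\<lambda>_. ennreal (\<bar>c\<bar> ^ DIM('a)))) f"
    using f by (subst (asm) lborel_affine[OF \<open>c \<noteq> 0\<close>, of 0]) simp
  then have "integrable lborel (\<lambda>x. \<bar>c\<bar> ^ DIM('a) *\<^sub>R f (c *\<^sub>R x))"
    by (subst (asm) integrable_density) (auto simp: integrable_distr_eq)
  from integrable_scaleR_right[OF this, of "inverse (\<bar>c\<bar> ^ DIM('a))"] show ?thesis
    using \<open>c \<noteq> 0\<close> by simp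
qed

section \<open>Volume of convex sublevel sets\<close>

lemma convex_combination_in_sublevel:
  fixes J :: "'a::real_vector \<Rightarrow> real"
  assumes "convex_on UNIV J" "J x \<le> M" "J y \<le> M" "0 \<le> t" "t \<le> 1"
  shows "J ((1 - t) *\<^sub>R x + t *\<^sub>R y) \<le> M"
proof -
  have "(1 - t) * J x + t * J y \<le> M"
    using assms(2-) by (intro convex_bound_le) auto
  then show ?thesis
    using convex_onD[OF assms(1,4,5), of x y] by simp
qed

text \<open>If \<open>norm u\<close> is large, the convex hull of \<open>cball 0 1\<close> and \<open>u\<close> contains balls of radius \<open>1/2\<close>
  centred at the points \<open>k *\<^sub>R sgn u\<close> with \<open>2 * k \<le> norm u\<close>.\<close>

lemma ball_subset_sublevel:
  fixes J :: "'a::real_normed_vector \<Rightarrow> real"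
  assumes J: "convex_on UNIV J" and M: "\<And>x. norm x \<le> 1 \<Longrightarrow> J x \<le> M" "J u \<le> M"
    and "u \<noteq> 0" and s: "0 \<le> s" "2 * s \<le> norm u" and y: "y \<in> ball (s *\<^sub>R sgn u) (1/2)"
  shows "J y \<le> M"
proof -
  \<comment> \<open>\<open>t\<close> is chosen so that
    \<open>t *\<^sub>R u = s *\<^sub>R sgn u\<close>, and \<open>b\<close> solves
    \<open>y = (1 - t) *\<^sub>R b + t *\<^sub>R u\<close>. As \<open>t \<le> 1/2\<close>, dividing
    by \<open>1 - t\<close> at most doubles an offset of at most \<open>1/2\<close>, so
    \<open>b\<close> lies in the unit ball.\<close>
  define t where "t = s / norm u"
  define b where "b = (y - s *\<^sub>R sgn u) /\<^sub>R (1 - t)"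
  have t: "0 \<le> t" "t \<le> 1/2"
    using assms by (auto simp: t_def field_simps)
  have "norm (y - s *\<^sub>R sgn u) \<le> 1/2"
    using y by (simp add: dist_norm norm_minus_commute)
  moreover have "inverse (1 - t) \<le> inverse (1/2)"
    using t by (intro le_imp_inverse_le) auto
  ultimately have "inverse (1 - t) * norm (y - s *\<^sub>R sgn u) \<le> inverse (1/2) * (1/2)"
    by (intro mult_mono) auto
  then have "norm b \<le> 1"
    unfolding b_def norm_scaleR using t by simp
  moreover have "y = (1 - t) *\<^sub>R b + t *\<^sub>R u"
  proof -
    have "(1 - t) *\<^sub>R b = y - s *\<^sub>R sgn u"
      using t unfolding b_def by simp
    moreover have "t *\<^sub>R u = s *\<^sub>R sgn u"
      unfolding t_def sgn_div_norm scaleR_scaleR divide_inverse ..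
    ultimately show ?thesis by simp
  qed
  ultimately show ?thesis
    using convex_combination_in_sublevel[OF J M(1) M(2)] t by auto
qed

lemma disjoint_family_balls_on_ray:
  fixes e :: "'a::real_normed_vector"
  assumes "norm e = 1"
  shows "disjoint_family (\<lambda>k::nat. ball (real k *\<^sub>R e) (1/2))"
proof (unfold disjoint_family_on_def, intro ballI impI)
  fix i j :: nat assume "i \<noteq> j"
  then have "1 \<le> \<bar>real i - real j\<bar>" by linarith
  also have "\<dots> = dist (real i *\<^sub>R e) (real j *\<^sub>R e)"
    using assms by (simp add: dist_norm flip: scaleR_diff_left)
  finally show "ball (real i *\<^sub>R e) (1/2) \<inter> ball (real j *\<^sub>R e) (1/2) = {}"
    by (intro disjoint_ballI) auto
qed

text \<open>Markov's inequality: \<open>exp M * exp (- J u)\<close> is at least 1 on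
  \<open>U\<close> and positive elsewhere, so it dominates the indicator.\<close>

lemma measure_le_integral_exp:
  fixes J :: "'a::euclidean_space \<Rightarrow> real"
  assumes "integrable lborel (\<lambda>u. exp (- J u))" and "U \<in> fmeasurable lborel"
    and "\<And>y. y \<in> U \<Longrightarrow> J y \<le> M"
  shows "measure lborel U \<le> exp M * (\<integral>u. exp (- J u) \<partial>lborel)"
proof -
  have "measure lborel U = (\<integral>u. indicator U u \<partial>lborel)"
    by simp
  also have "\<dots> \<le> (\<integral>u. exp M * exp (- J u) \<partial>lborel)"
  proof (rule integral_mono)
    show "integrable lborel (indicator U :: 'a \<Rightarrow> real)"
      using assms(2) by (simp add: fmeasurable_def)
    show "indicator U u \<le> exp M * exp (- J u)" for u
      using assms(3)[of u] by (auto simp: indicator_def simp flip: exp_add)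
  qed (use assms(1) in simp)
  finally show ?thesis by simp
qed

lemma bounded_sublevel_of_integrable_exp:
  fixes J :: "'a::euclidean_space \<Rightarrow> real"
  assumes J: "convex_on UNIV J" and int: "integrable lborel (\<lambda>u. exp (- J u))"
    and M: "\<And>x. norm x \<le> 1 \<Longrightarrow> J x \<le> M"
  shows "bounded {u. J u \<le> M}"
proof -
  define c where "c = measure lborel (ball (0::'a) (1/2))"
  define I where "I = exp M * (\<integral>u. exp (- J u) \<partial>lborel)"
  have "c > 0"
    unfolding c_def by (simp add: content_ball_pos)
  then obtain N :: nat where N: "I < real N * c"
    using reals_Archimedean3 by blast
  \<comment> \<open>Beyond this radius all \<open>N\<close> centres \<open>k *\<^sub>R sgn u\<close>
    satisfy \<open>2 * k \<le> norm u\<close>, and the balls around them have total volume above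
    \<open>I\<close>. The extra 1 ensures \<open>u \<noteq> 0\<close>.\<close>
  have "norm u < 2 * real N + 1" if u: "J u \<le> M" for u
  proof (rule ccontr)
    assume "\<not> norm u < 2 * real N + 1"
    then have large: "2 * real N + 1 \<le> norm u" by simp
    then have "u \<noteq> 0" by auto
    define B where "B k = ball (real k *\<^sub>R sgn u) (1/2)" for k
    have "real N * c = (\<Sum>k<N. measure lborel (B k))"
      unfolding B_def c_def by (simp add: content_ball)
    also have "\<dots> = measure lborel (\<Union>k<N. B k)"
    proof (rule measure_finite_Union[symmetric])
      show "disjoint_family_on B {..<N}"
        unfolding B_def
        by (rule disjoint_family_on_mono[OF _ disjoint_family_balls_on_ray])
          (use \<open>u \<noteq> 0\<close> in \<open>auto simp: norm_sgn\<close>)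
      show "emeasure lborel (B i) \<noteq> \<infinity>" for i
        unfolding B_def using emeasure_lborel_ball_finite[of "real i *\<^sub>R sgn u" "1/2"] by auto
    qed (auto simp: B_def)
    also have "\<dots> \<le> I"
      unfolding I_def
    proof (rule measure_le_integral_exp[OF int])
      show "(\<Union>k<N. B k) \<in> fmeasurable lborel"
        by (intro fmeasurable.finite_UN) (use emeasure_lborel_ball_finite in \<open>auto simp: B_def fmeasurable_def\<close>)
      show "J y \<le> M" if y: "y \<in> (\<Union>k<N. B k)" for y
      proof -
        obtain k where "k < N" "y \<in> B k" using y by auto
        then show ?thesis
          using ball_subset_sublevel[OF J M u \<open>u \<noteq> 0\<close>, of "real k" y] large by (auto simp: B_def)
      qed
    qed
    finally show False using N by simp
  qed
  then show ?thesis
    by (intro boundedI[of _ "2 * real N + 1"]) (auto intro: less_imp_le)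
qed

section \<open>Linear growth and first moments\<close>

lemma linear_growth_of_integrable_exp:
  fixes J :: "'a::euclidean_space \<Rightarrow> real"
  assumes J: "convex_on UNIV J" and int: "integrable lborel (\<lambda>u. exp (- J u))"
  obtains a b where "a > 0" "\<And>u. a * norm u - b \<le> J u"
proof -
  have cont: "continuous_on A J" for A
    using convex_on_continuous[OF open_UNIV J] continuous_on_subset by blast
  have bdd: "\<exists>B. \<forall>x\<in>cball 0 r. \<bar>J x\<bar> \<le> B" for r
    using compact_imp_bounded[OF compact_continuous_image[OF cont compact_cball[of 0 r]]]
    by (auto simp: bounded_iff)
  obtain M where M: "\<And>x. norm x \<le> 1 \<Longrightarrow> J x \<le> M"
    using bdd[of 1] unfolding mem_cball_0[symmetric] by (blast dest: abs_le_D1)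
  \<comment> \<open>The level \<open>M + 1\<close> leaves a gap of 1 above \<open>J 0\<close>;
    gained over a distance \<open>r\<close>, it yields the slope \<open>1 / r\<close>.\<close>
  have "bounded {u. J u \<le> M + 1}"
    by (rule bounded_sublevel_of_integrable_exp[OF J int]) (rule order_trans[OF M], auto)
  then obtain r where r: "r > 0" "\<And>u. J u \<le> M + 1 \<Longrightarrow> norm u < r"
    by (auto simp: bounded_pos_less)
  obtain B where B: "\<And>x. norm x \<le> r \<Longrightarrow> \<bar>J x\<bar> \<le> B"
    using bdd[of r] unfolding mem_cball_0[symmetric] by blast
  have "1 / r * norm u - (\<bar>M\<bar> + \<bar>B\<bar> + 1) \<le> J u" for u
  proof (cases "norm u \<le> r")
    case True
    then have "1 / r * norm u \<le> 1"
      using \<open>r > 0\<close> by simp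
    then show ?thesis
      using B[OF True] by linarith
  next
    case False
    \<comment> \<open>\<open>t *\<^sub>R u\<close> lies on the sphere of radius \<open>r\<close>,
      where \<open>J\<close> exceeds \<open>M + 1\<close>. Convexity on the segment from 0 to
      \<open>u\<close> carries this rise on to \<open>u\<close>, and
      \<open>1 / t = norm u / r\<close>.\<close>
    define t where "t = r / norm u"
    have "0 < norm u" using False \<open>r > 0\<close> by linarith
    then have t: "0 < t" "t \<le> 1" "norm (t *\<^sub>R u) = r"
      using False \<open>r > 0\<close> by (simp_all add: t_def)
    have "M + 1 < J (t *\<^sub>R u)"
      using r(2)[of "t *\<^sub>R u"] t(3) by linarith
    also have "\<dots> \<le> (1 - t) * J 0 + t * J u"
      using convex_onD[OF J, of t 0 u] t by simp
    also have "\<dots> \<le> (1 - t) * M + t * J u"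
      using M[of 0] t by (simp add: mult_left_mono)
    finally have "1 + t * M < t * J u" by (simp add: algebra_simps)
    then have "1 / t + M < J u"
      using t(1) by (simp add: field_simps)
    then show ?thesis by (simp add: t_def)
  qed
  with \<open>r > 0\<close> show ?thesis
    by (intro that[of "1 / r" "\<bar>M\<bar> + \<bar>B\<bar> + 1"]) auto
qed

text \<open>Convexity gives \<open>J (u / 2) \<le> (J 0 + J u) / 2\<close>, so \<open>exp (- J u / 2)\<close> is dominated by a rescaling
  of \<open>exp (- J)\<close>.\<close>

lemma integrable_exp_half:
  fixes J :: "'a::euclidean_space \<Rightarrow> real"
  assumes J: "convex_on UNIV J" and int: "integrable lborel (\<lambda>u. exp (- J u))"
  shows "integrable lborel (\<lambda>u. exp (- J u / 2))"
proof (rule Bochner_Integration.integrable_bound)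
  show "integrable lborel (\<lambda>u. exp (J 0 / 2) * exp (- J ((1/2) *\<^sub>R u)))"
    using integrable_lborel_scaleR[OF int, of "1/2"] by simp
  have [measurable]: "J \<in> borel_measurable borel"
    by (intro borel_measurable_continuous_onI convex_on_continuous[OF open_UNIV J])
  show "(\<lambda>u. exp (- J u / 2)) \<in> borel_measurable lborel"
    by measurable
  have "- J u / 2 \<le> J 0 / 2 + - J ((1/2) *\<^sub>R u)" for u
    using convex_onD[OF J, of "1/2" 0 u] by simp
  then show "AE u in lborel. norm (exp (- J u / 2)) \<le> norm (exp (J 0 / 2) * exp (- J ((1/2) *\<^sub>R u)))"
    by (simp flip: exp_add)
qed

text \<open>Split \<open>exp (- J u)\<close> into two equal factors: by linear growth one absorbs
  \<open>norm u\<close> up to a constant, and the other is integrable.\<close>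

lemma integrable_norm_times_exp:
  fixes J :: "'a::euclidean_space \<Rightarrow> real"
  assumes J: "convex_on UNIV J" and int: "integrable lborel (\<lambda>u. exp (- J u))"
  shows "integrable lborel (\<lambda>u. norm u * exp (- J u))"
proof -
  obtain a b where "a > 0" and growth: "\<And>u. a * norm u - b \<le> J u"
    using linear_growth_of_integrable_exp[OF J int] by blast
  have bound: "norm u * exp (- J u) \<le> 2 / a * exp (b / 2) * exp (- J u / 2)" for u
  proof -
    have exp_half: "x \<le> 2 * exp (x / 2)" for x :: real
      using exp_ge_add_one_self[of "x / 2"] by linarith
    have "a * norm u \<le> J u + b"
      using growth[of u] by simp
    also have "\<dots> \<le> 2 * exp ((J u + b) / 2)"
      by (rule exp_half)
    finally have "norm u \<le> 2 / a * exp ((J u + b) / 2)"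
      using \<open>a > 0\<close> by (simp add: field_simps)
    then have "norm u * exp (- J u) \<le> 2 / a * (exp ((J u + b) / 2) * exp (- J u))"
      by (subst mult.assoc[symmetric], intro mult_right_mono) auto
    also have "exp ((J u + b) / 2) * exp (- J u) = exp (b / 2) * exp (- J u / 2)"
      by (simp add: field_simps flip: exp_add)
    finally show ?thesis by (simp add: mult.assoc)
  qed
  have [measurable]: "J \<in> borel_measurable borel"
    by (intro borel_measurable_continuous_onI convex_on_continuous[OF open_UNIV J])
  show ?thesis
  proof (rule Bochner_Integration.integrable_bound)
    show "integrable lborel (\<lambda>u. 2 / a * exp (b / 2) * exp (- J u / 2))"
      using integrable_exp_half[OF J int] by simp
  qed (use bound \<open>a > 0\<close> in \<open>auto simp: abs_mult\<close>)
qed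

section \<open>Expected Bregman distances\<close>

lemma expectation_bregman_distance:
  fixes R :: "'a::euclidean_space \<Rightarrow> real"
  assumes p: "has_bochner_integral lborel p 1"
    and u: "integrable lborel (\<lambda>u. p u *\<^sub>R u)" and R: "integrable lborel (\<lambda>u. p u * R u)"
  shows "expectation p (\<lambda>u. bregman_distance R q u v)
           = expectation p R - (R v + q \<bullet> (expectation p (\<lambda>u. u) - v))"
proof -
  have p': "integrable lborel p" "integral\<^sup>L lborel p = 1"
    using p by (auto simp: has_bochner_integral_iff)
  have "expectation p (\<lambda>u. bregman_distance R q u v)
          = (\<integral>u. p u * R u - (p u * (R v - q \<bullet> v) + q \<bullet> (p u *\<^sub>R u)) \<partial>lborel)"
    unfolding expectation_def bregman_distance_def
    by (rule Bochner_Integration.integral_cong) (auto simp: algebra_simps)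
  \<comment> \<open>Every summand is integrable, so the integral splits, and the continuous
    functional given by \<open>q\<close> commutes with the vector-valued integral.\<close>
  also have "\<dots> = (\<integral>u. p u * R u \<partial>lborel) - ((R v - q \<bullet> v) + q \<bullet> (\<integral>u. p u *\<^sub>R u \<partial>lborel))"
    using p' u R by (simp del: inner_scaleR_right)
  finally show ?thesis
    by (simp add: expectation_def inner_diff_right)
qed

theorem theorem5p1:
  fixes K :: "real ^ 'n ^ 'm"
    and f :: "real ^ 'm"
    and \<alpha> :: real
    and E :: "real ^ 'n \<Rightarrow> real ^ 'n ^ 'm \<Rightarrow> real ^ 'm \<Rightarrow> real"
    and R :: "real ^ 'n \<Rightarrow> real"
    and p :: "real ^ 'n \<Rightarrow> real"
    and u_CM u_MAP q_CM q_MAP :: "real ^ 'n"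
  assumes "\<alpha> > 0"
    and "\<And>u. E u K f \<ge> 0"
    and "convex_on UNIV (\<lambda>u. E u K f)"
    and "\<exists>L. L-lipschitz_on UNIV (\<lambda>u. E u K f)"
    and "\<And>u. R u \<ge> 0"
    and "convex_on UNIV R"
    and "\<exists>L. L-lipschitz_on UNIV R"
    and "integrable lborel (\<lambda>u. exp (- E u K f - \<alpha> * R u))"
    and "normalized_density (\<lambda>u. exp (- E u K f - \<alpha> * R u)) p"
    and "u_CM = expectation p (\<lambda>u. u)"
    and "is_arg_max p (\<lambda>_. True) u_MAP"
    and "q_CM \<in> subdifferential R u_CM"
    and "q_MAP \<in> subdifferential R u_MAP"
  shows "expectation p (\<lambda>u. bregman_distance R q_CM u u_CM)
           \<le> expectation p (\<lambda>u. bregman_distance R q_MAP u u_MAP)"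
proof -
  define J where "J u = E u K f + \<alpha> * R u" for u
  have J: "convex_on UNIV J"
    unfolding J_def using assms(1,3,6) by (intro convex_on_add convex_on_cmul) auto
  have eq: "- E u K f - \<alpha> * R u = - J u" for u by (simp add: J_def)
  have int: "integrable lborel (\<lambda>u. exp (- J u))"
    using assms(8) by (simp add: eq)
  obtain c where "c > 0" and pc: "\<And>u. p u = c * exp (- J u)"
    and p: "has_bochner_integral lborel p 1"
    using assms(9) by (auto simp: normalized_density_def eq)
  have [measurable]: "J \<in> borel_measurable borel" "R \<in> borel_measurable borel"
    using convex_on_continuous[OF open_UNIV] J assms(6)
    by (auto intro!: borel_measurable_continuous_onI)
  have [measurable]: "p \<in> borel_measurable borel"
    unfolding pc[abs_def] by measurable
  have moment: "integrable lborel (\<lambda>u. p u *\<^sub>R u)"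
  proof (rule Bochner_Integration.integrable_bound)
    show "integrable lborel (\<lambda>u. c * (norm u * exp (- J u)))"
      using integrable_norm_times_exp[OF J int] by simp
  qed (auto simp: pc abs_mult)
  obtain L where L: "L-lipschitz_on UNIV R" using assms(7) by blast
  have R: "integrable lborel (\<lambda>u. p u * R u)"
  proof (rule Bochner_Integration.integrable_bound)
    show "integrable lborel (\<lambda>u. R 0 * p u + L * (c * (norm u * exp (- J u))))"
      using integrable_norm_times_exp[OF J int] p by (simp add: has_bochner_integral_iff)
    \<comment> \<open>The Lipschitz bound \<open>R u \<le> R 0 + L * norm u\<close> reduces
      integrability of \<open>R\<close> to the total mass and the first moment.\<close>
    have "\<bar>p u * R u\<bar> \<le> R 0 * p u + L * (c * (norm u * exp (- J u)))" for u
    proof -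
      have "R u \<le> R 0 + L * norm u"
        using lipschitz_onD[OF L, of u 0] by (simp add: dist_norm)
      then have "p u * R u \<le> p u * (R 0 + L * norm u)"
        using \<open>c > 0\<close> by (intro mult_left_mono) (auto simp: pc)
      moreover have "0 \<le> p u * R u"
        using \<open>c > 0\<close> assms(5)[of u] by (simp add: pc)
      ultimately show ?thesis by (simp add: pc algebra_simps)
    qed
    then show "AE u in lborel. norm (p u * R u) \<le> norm (R 0 * p u + L * (c * (norm u * exp (- J u))))"
      unfolding real_norm_def by (rule AE_I2[OF order_trans[OF _ abs_ge_self]])
  qed simp
  \<comment> \<open>The subgradient inequality at \<open>u_MAP\<close> is tested at the mean; for
    the other distance the linear term \<open>q_CM \<bullet> (u_CM - u_CM)\<close> vanishes.\<close>
  have "R u_MAP + q_MAP \<bullet> (u_CM - u_MAP) \<le> R u_CM"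
    using assms(13) by (simp add: subdifferential_def)
  then show ?thesis
    by (simp add: expectation_bregman_distance[OF p moment R] flip: assms(10))
qed

end
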